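(* Let $\overline f,\overline t,\overline a$ be given binary first-leg, third-leg and allocation vectors such that, together with at least one choice of $(x,s)$, they satisfy the leader constraints (L1)–(L6) of the context. Define outsourcing fees $(\overline p,\overline q)$ as follows. For each $r\in R$ with $o(r)\notin H$: if there are $k(r)\in K$ and $i(r)\in H$ with $\overline a_{o(r)k(r)}=1$ and $\overline f^{\,rk(r)}_{i(r)}=1$, put $$\overline p^r_i=\begin{cases}\overline c^{\,rk(r)}_{o(r)i} & \text{if } i=i(r),\\ 0&\text{otherwise,}\end{cases}\qquad i\in H,$$ and put $\overline p^r_i=0$ for all $i\in H$ if no such pair exists. For each $r\in R$ with $d(r)\notin H$: if there are $l(r)\in K$ and $j(r)\in H$ with $\overline a_{d(r)l(r)}=1$ and $\overline t^{\,rl(r)}_{j(r)}=1$, put $$\overline q^r_i=\begin{cases}\overline c^{\,rl(r)}_{id(r)} & \text{if } i=j(r),\\ 0&\text{otherwise,}\end{cases}\qquad i\in H,$$ and put $\overline q^r_i=0$ for all $i\in H$ if no such pair exists. Then the fees $(\overline p,\overline q)$ are optimal for $\overline f,\overline t,\overline a$ for both the Multi-Commodity Flow Problem with Outsourcing Decisions (MCFOD) and its relaxed version ($r$MCFOD): each of the two problems obtained by fixing $f=\overline f$, $t=\overline t$, $a=\overline a$ has an optimal solution whose fee vectors are $p=\overline p$, $q=\overline q$.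
   Context: Data. $V$ is a finite node set, $\emptyset\ne H\subset V$ the set of hubs, $K$ a finite nonempty set of carriers, $R$ a finite set of commodities. Each $r\in R$ has an origin $o(r)\in V$, a destination $d(r)\in V$, not both in $H$, and a revenue $b^r>0$. For $r\in R$ and $i,j\in H$ (possibly $i=j$), $c^r_{ij}>0$ is the leader's interhub routing cost (for each $r$ it satisfies the triangle inequality). For $k\in K$, $i\in H$: $\overline c^{\,rk}_{o(r)i}>0$ (if $o(r)\notin H$) and $\overline c^{\,rk}_{id(r)}>0$ (if $d(r)\notin H$) are the reservation prices of carrier $k$ for the first leg of $r$ (from $o(r)$ to hub $i$) and the third leg of $r$ (from hub $i$ to $d(r)$). The set of potential interhub arcs of $r$ is $A^r=\{(o(r),j):j\in H\}$ if $o(r)\in H,d(r)\notin H$; $A^r=\{(i,d(r)):i\in H\}$ if $o(r)\notin H,d(r)\in H$; $A^r=H\times H$ if $o(r),d(r)\notin H$. Variables. $s^r\in\{0,1\}$ ($r$ is served); $a_{ik}\in\{0,1\}$ ($i\in V\setminus H$ is allocated to carrier $k$); $x^r_{ij}\in\{0,1\}$, $(i,j)\in A^r$ ($r$ is routed through interhub arc $(i,j)$); $f^{rk}_i\in\{0,1\}$, $i\in H$, for $r$ with $o(r)\notin H$ (carrier $k$ accepts the first leg of $r$ through $i$); $t^{rk}_i\in\{0,1\}$, $i\in H$, for $r$ with $d(r)\notin H$ (carrier $k$ accepts the third leg of $r$ through $i$); outsourcing fees $p^r_i\ge 0$ (for $o(r)\notin H$) and $q^r_i\ge0$ (for $d(r)\notin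 H$), $i\in H$. First-leg fee terms are absent (read as $0$) when $o(r)\in H$, third-leg fee terms when $d(r)\in H$. Leader constraints: (L1) $\sum_{k\in K}a_{ik}\le 1$ for $i\in V\setminus H$; (L2) $\sum_{k\in K}f^{rk}_i\ge\sum_{j:(i,j)\in A^r}x^r_{ij}$ for $r\in R$ with $o(r)\notin H$, $i\in H$; (L3) $\sum_{k\in K}t^{rk}_i\ge\sum_{j:(j,i)\in A^r}x^r_{ji}$ for $r\in R$ with $d(r)\notin H$, $i\in H$; (L4) $\sum_{(i,j)\in A^r}x^r_{ij}=s^r$ for $r\in R$; (L5) $\sum_{i\in H}f^{rk}_i\le a_{o(r)k}$ for $k\in K$, $r\in R$ with $o(r)\notin H$; (L6) $\sum_{i\in H}t^{rk}_i\le a_{d(r)k}$ for $k\in K$, $r\in R$ with $d(r)\notin H$. Write $\rho^{rk}_i=p^r_i-\overline c^{\,rk}_{o(r)i}$, $\gamma^{rk}_i=q^r_i-\overline c^{\,rk}_{id(r)}$ and $[\alpha]^+=\max\{0,\alpha\}$. MCFOD: maximize $\sum_{r\in R}b^rs^r-\sum_{r\in R}\sum_{(i,j)\in A^r}(c^r_{ij}+p^r_i+q^r_j)x^r_{ij}$ subject to (L1)–(L6) and the carriers' optimality conditions $a_{o(r)k}\big[\max_{i\in H}\rho^{rk}_i\big]^+\le\sum_{i\in H}\rho^{rk}_if^{rk}_i$ (for $k\in K$, $o(r)\notin H$) and $a_{d(r)k}\big[\max_{i\in H}\gamma^{rk}_i\big]^+\le\sum_{i\in H}\gamma^{rk}_it^{rk}_i$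 (for $k\in K$, $d(r)\notin H$). $r$MCFOD: the same problem with the carriers' optimality conditions replaced by $\sum_{i\in H}\rho^{rk}_if^{rk}_i\ge0$ and $\sum_{i\in H}\gamma^{rk}_it^{rk}_i\ge 0$, for the same indices. When $f,t,a$ are fixed, the remaining decision variables are $x,s,p,q$. *)

theory Defs
  imports Complex_Main
begin

text \<open>
  \<open>res_price I r k u v\<close> is carrier \<open>k\<close>'s reservation price for commodity \<open>r\<close> on the arc \<open>(u, v)\<close>.
  It is only meaningful on first-leg arcs \<open>(orig I r, i)\<close> and third-leg arcs \<open>(i, dest I r)\<close>
  with \<open>i\<close> a hub and the other endpoint not a hub.
\<close>

record ('v, 'k, 'r) mcfod_data =
  nodes :: "'v set"
  hubs :: "'v set"
  carriers :: "'k set"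
  commodities :: "'r set"
  orig :: "'r \<Rightarrow> 'v"
  dest :: "'r \<Rightarrow> 'v"
  revenue :: "'r \<Rightarrow> real"
  hub_cost :: "'r \<Rightarrow> 'v \<Rightarrow> 'v \<Rightarrow> real"
  res_price :: "'r \<Rightarrow> 'k \<Rightarrow> 'v \<Rightarrow> 'v \<Rightarrow> real"

definition mcfod_instance :: "('v, 'k, 'r) mcfod_data \<Rightarrow> bool" where
  "mcfod_instance I \<longleftrightarrow>
     finite (nodes I) \<and> hubs I \<noteq> {} \<and> hubs I \<subseteq> nodes I \<and>
     finite (carriers I) \<and> carriers I \<noteq> {} \<and>
     finite (commodities I) \<and>
     (\<forall>r\<in>commodities I.
        orig I r \<in> nodes I \<and> dest I r \<in> nodes I \<and>
        \<not> (orig I r \<in> hubs I \<and> dest I r \<in> hubs I) \<and>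
        revenue I r > 0 \<and>
        (\<forall>i\<in>hubs I. \<forall>j\<in>hubs I. hub_cost I r i j > 0) \<and>
        (\<forall>i\<in>hubs I. \<forall>j\<in>hubs I. \<forall>l\<in>hubs I.
           hub_cost I r i j \<le> hub_cost I r i l + hub_cost I r l j) \<and>
        (\<forall>k\<in>carriers I. \<forall>i\<in>hubs I.
           (orig I r \<notin> hubs I \<longrightarrow> res_price I r k (orig I r) i > 0) \<and>
           (dest I r \<notin> hubs I \<longrightarrow> res_price I r k i (dest I r) > 0)))"

text \<open>In an instance, origin and destination are never both hubs, so the three cases are exhaustive.\<close>

definition arcs :: "('v, 'k, 'r) mcfod_data \<Rightarrow> 'r \<Rightarrow> ('v \<times> 'v) set" where
  "arcs I r =
     (if orig I r \<in> hubs I then {orig I r} \<times> hubs I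
      else if dest I r \<in> hubs I then hubs I \<times> {dest I r}
      else hubs I \<times> hubs I)"

text \<open>
  Decision variables are total functions constrained only on the index ranges of the model:
  \<open>s r\<close>, \<open>a i k\<close>, \<open>x r i j\<close>, \<open>f r k i\<close>, \<open>t r k i\<close>, \<open>p r i\<close>, \<open>q r i\<close>.
  Values outside those ranges never enter a constraint or the objective.
\<close>

definition binary_allocation ::
  "('v, 'k, 'r) mcfod_data \<Rightarrow> ('v \<Rightarrow> 'k \<Rightarrow> real) \<Rightarrow>
   ('r \<Rightarrow> 'k \<Rightarrow> 'v \<Rightarrow> real) \<Rightarrow> ('r \<Rightarrow> 'k \<Rightarrow> 'v \<Rightarrow> real) \<Rightarrow> bool" where
  "binary_allocation I a f t \<longleftrightarrow>
     (\<forall>i\<in>nodes I - hubs I. \<forall>k\<in>carriers I. a i k \<in> {0, 1}) \<and>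
     (\<forall>r\<in>commodities I. \<forall>k\<in>carriers I. \<forall>i\<in>hubs I.
        (orig I r \<notin> hubs I \<longrightarrow> f r k i \<in> {0, 1}) \<and>
        (dest I r \<notin> hubs I \<longrightarrow> t r k i \<in> {0, 1}))"

definition binary_routing ::
  "('v, 'k, 'r) mcfod_data \<Rightarrow> ('r \<Rightarrow> real) \<Rightarrow> ('r \<Rightarrow> 'v \<Rightarrow> 'v \<Rightarrow> real) \<Rightarrow> bool" where
  "binary_routing I s x \<longleftrightarrow>
     (\<forall>r\<in>commodities I. s r \<in> {0, 1} \<and> (\<forall>(i, j)\<in>arcs I r. x r i j \<in> {0, 1}))"

definition leader_constraints ::
  "('v, 'k, 'r) mcfod_data \<Rightarrow> ('r \<Rightarrow> real) \<Rightarrow> ('v \<Rightarrow> 'k \<Rightarrow> real) \<Rightarrow>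
   ('r \<Rightarrow> 'v \<Rightarrow> 'v \<Rightarrow> real) \<Rightarrow> ('r \<Rightarrow> 'k \<Rightarrow> 'v \<Rightarrow> real) \<Rightarrow>
   ('r \<Rightarrow> 'k \<Rightarrow> 'v \<Rightarrow> real) \<Rightarrow> bool" where
  "leader_constraints I s a x f t \<longleftrightarrow>
     (\<forall>i\<in>nodes I - hubs I. (\<Sum>k\<in>carriers I. a i k) \<le> 1) \<and>
     (\<forall>r\<in>commodities I. orig I r \<notin> hubs I \<longrightarrow>
        (\<forall>i\<in>hubs I. (\<Sum>k\<in>carriers I. f r k i) \<ge> (\<Sum>j | (i, j) \<in> arcs I r. x r i j))) \<and>
     (\<forall>r\<in>commodities I. dest I r \<notin> hubs I \<longrightarrow>
        (\<forall>i\<in>hubs I. (\<Sum>k\<in>carriers I. t r k i) \<ge> (\<Sum>j | (j, i) \<in> arcs I r. x r j i))) \<and>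
     (\<forall>r\<in>commodities I. (\<Sum>(i, j)\<in>arcs I r. x r i j) = s r) \<and>
     (\<forall>k\<in>carriers I. \<forall>r\<in>commodities I. orig I r \<notin> hubs I \<longrightarrow>
        (\<Sum>i\<in>hubs I. f r k i) \<le> a (orig I r) k) \<and>
     (\<forall>k\<in>carriers I. \<forall>r\<in>commodities I. dest I r \<notin> hubs I \<longrightarrow>
        (\<Sum>i\<in>hubs I. t r k i) \<le> a (dest I r) k)"

definition nonneg_fees ::
  "('v, 'k, 'r) mcfod_data \<Rightarrow> ('r \<Rightarrow> 'v \<Rightarrow> real) \<Rightarrow> ('r \<Rightarrow> 'v \<Rightarrow> real) \<Rightarrow> bool" where
  "nonneg_fees I p q \<longleftrightarrow>
     (\<forall>r\<in>commodities I. \<forall>i\<in>hubs I.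
        (orig I r \<notin> hubs I \<longrightarrow> p r i \<ge> 0) \<and> (dest I r \<notin> hubs I \<longrightarrow> q r i \<ge> 0))"

definition rho ::
  "('v, 'k, 'r) mcfod_data \<Rightarrow> ('r \<Rightarrow> 'v \<Rightarrow> real) \<Rightarrow> 'r \<Rightarrow> 'k \<Rightarrow> 'v \<Rightarrow> real" where
  "rho I p r k i = p r i - res_price I r k (orig I r) i"

definition gam ::
  "('v, 'k, 'r) mcfod_data \<Rightarrow> ('r \<Rightarrow> 'v \<Rightarrow> real) \<Rightarrow> 'r \<Rightarrow> 'k \<Rightarrow> 'v \<Rightarrow> real" where
  "gam I q r k i = q r i - res_price I r k i (dest I r)"

definition carrier_optimality ::
  "('v, 'k, 'r) mcfod_data \<Rightarrow> ('v \<Rightarrow> 'k \<Rightarrow> real) \<Rightarrow>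
   ('r \<Rightarrow> 'k \<Rightarrow> 'v \<Rightarrow> real) \<Rightarrow> ('r \<Rightarrow> 'k \<Rightarrow> 'v \<Rightarrow> real) \<Rightarrow>
   ('r \<Rightarrow> 'v \<Rightarrow> real) \<Rightarrow> ('r \<Rightarrow> 'v \<Rightarrow> real) \<Rightarrow> bool" where
  "carrier_optimality I a f t p q \<longleftrightarrow>
     (\<forall>k\<in>carriers I. \<forall>r\<in>commodities I.
        (orig I r \<notin> hubs I \<longrightarrow>
           a (orig I r) k * max 0 (Max ((\<lambda>i. rho I p r k i) ` hubs I))
             \<le> (\<Sum>i\<in>hubs I. rho I p r k i * f r k i)) \<and>
        (dest I r \<notin> hubs I \<longrightarrow>
           a (dest I r) k * max 0 (Max ((\<lambda>i. gam I q r k i) ` hubs I))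
             \<le> (\<Sum>i\<in>hubs I. gam I q r k i * t r k i)))"

definition carrier_rationality ::
  "('v, 'k, 'r) mcfod_data \<Rightarrow>
   ('r \<Rightarrow> 'k \<Rightarrow> 'v \<Rightarrow> real) \<Rightarrow> ('r \<Rightarrow> 'k \<Rightarrow> 'v \<Rightarrow> real) \<Rightarrow>
   ('r \<Rightarrow> 'v \<Rightarrow> real) \<Rightarrow> ('r \<Rightarrow> 'v \<Rightarrow> real) \<Rightarrow> bool" where
  "carrier_rationality I f t p q \<longleftrightarrow>
     (\<forall>k\<in>carriers I. \<forall>r\<in>commodities I.
        (orig I r \<notin> hubs I \<longrightarrow> (\<Sum>i\<in>hubs I. rho I p r k i * f r k i) \<ge> 0) \<and>
        (dest I r \<notin> hubs I \<longrightarrow> (\<Sum>i\<in>hubs I. gam I q r k i * t r k i) \<ge> 0))"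

definition mcfod_feasible ::
  "('v, 'k, 'r) mcfod_data \<Rightarrow> ('r \<Rightarrow> real) \<Rightarrow> ('v \<Rightarrow> 'k \<Rightarrow> real) \<Rightarrow>
   ('r \<Rightarrow> 'v \<Rightarrow> 'v \<Rightarrow> real) \<Rightarrow> ('r \<Rightarrow> 'k \<Rightarrow> 'v \<Rightarrow> real) \<Rightarrow>
   ('r \<Rightarrow> 'k \<Rightarrow> 'v \<Rightarrow> real) \<Rightarrow> ('r \<Rightarrow> 'v \<Rightarrow> real) \<Rightarrow> ('r \<Rightarrow> 'v \<Rightarrow> real) \<Rightarrow> bool" where
  "mcfod_feasible I s a x f t p q \<longleftrightarrow>
     binary_allocation I a f t \<and> binary_routing I s x \<and> nonneg_fees I p q \<and>
     leader_constraints I s a x f t \<and> carrier_optimality I a f t p q"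

definition rmcfod_feasible ::
  "('v, 'k, 'r) mcfod_data \<Rightarrow> ('r \<Rightarrow> real) \<Rightarrow> ('v \<Rightarrow> 'k \<Rightarrow> real) \<Rightarrow>
   ('r \<Rightarrow> 'v \<Rightarrow> 'v \<Rightarrow> real) \<Rightarrow> ('r \<Rightarrow> 'k \<Rightarrow> 'v \<Rightarrow> real) \<Rightarrow>
   ('r \<Rightarrow> 'k \<Rightarrow> 'v \<Rightarrow> real) \<Rightarrow> ('r \<Rightarrow> 'v \<Rightarrow> real) \<Rightarrow> ('r \<Rightarrow> 'v \<Rightarrow> real) \<Rightarrow> bool" where
  "rmcfod_feasible I s a x f t p q \<longleftrightarrow>
     binary_allocation I a f t \<and> binary_routing I s x \<and> nonneg_fees I p q \<and>
     leader_constraints I s a x f t \<and> carrier_rationality I f t p q"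

text \<open>A fee term is absent when the corresponding endpoint of the commodity is itself a hub.\<close>

definition profit ::
  "('v, 'k, 'r) mcfod_data \<Rightarrow> ('r \<Rightarrow> real) \<Rightarrow> ('r \<Rightarrow> 'v \<Rightarrow> 'v \<Rightarrow> real) \<Rightarrow>
   ('r \<Rightarrow> 'v \<Rightarrow> real) \<Rightarrow> ('r \<Rightarrow> 'v \<Rightarrow> real) \<Rightarrow> real" where
  "profit I s x p q =
     (\<Sum>r\<in>commodities I. revenue I r * s r) -
     (\<Sum>r\<in>commodities I. \<Sum>(i, j)\<in>arcs I r.
        (hub_cost I r i j
          + (if orig I r \<in> hubs I then 0 else p r i)
          + (if dest I r \<in> hubs I then 0 else q r j)) * x r i j)"

text \<open>
  The problems with \<open>f\<close>, \<open>t\<close>, \<open>a\<close> fixed: the decision variables are \<open>(s, x, p, q)\<close>.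
\<close>

definition mcfod_fixed_optimal ::
  "('v, 'k, 'r) mcfod_data \<Rightarrow> ('r \<Rightarrow> 'k \<Rightarrow> 'v \<Rightarrow> real) \<Rightarrow>
   ('r \<Rightarrow> 'k \<Rightarrow> 'v \<Rightarrow> real) \<Rightarrow> ('v \<Rightarrow> 'k \<Rightarrow> real) \<Rightarrow>
   ('r \<Rightarrow> real) \<times> ('r \<Rightarrow> 'v \<Rightarrow> 'v \<Rightarrow> real) \<times> ('r \<Rightarrow> 'v \<Rightarrow> real) \<times> ('r \<Rightarrow> 'v \<Rightarrow> real) \<Rightarrow> bool" where
  "mcfod_fixed_optimal I f t a =
     is_arg_max (\<lambda>(s, x, p, q). profit I s x p q) (\<lambda>(s, x, p, q). mcfod_feasible I s a x f t p q)"

definition rmcfod_fixed_optimal ::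
  "('v, 'k, 'r) mcfod_data \<Rightarrow> ('r \<Rightarrow> 'k \<Rightarrow> 'v \<Rightarrow> real) \<Rightarrow>
   ('r \<Rightarrow> 'k \<Rightarrow> 'v \<Rightarrow> real) \<Rightarrow> ('v \<Rightarrow> 'k \<Rightarrow> real) \<Rightarrow>
   ('r \<Rightarrow> real) \<times> ('r \<Rightarrow> 'v \<Rightarrow> 'v \<Rightarrow> real) \<times> ('r \<Rightarrow> 'v \<Rightarrow> real) \<times> ('r \<Rightarrow> 'v \<Rightarrow> real) \<Rightarrow> bool" where
  "rmcfod_fixed_optimal I f t a =
     is_arg_max (\<lambda>(s, x, p, q). profit I s x p q) (\<lambda>(s, x, p, q). rmcfod_feasible I s a x f t p q)"

text \<open>
  The fees induced by \<open>f\<close>, \<open>t\<close>, \<open>a\<close>, as predicates on the fee vectors: the construction picks, for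
  each commodity, some accepting carrier \<open>k\<close> and hub \<open>i\<close>, and every such choice is covered.
  (The leader constraints make the pair unique when it exists.)
\<close>

definition induced_first_fees ::
  "('v, 'k, 'r) mcfod_data \<Rightarrow> ('r \<Rightarrow> 'k \<Rightarrow> 'v \<Rightarrow> real) \<Rightarrow> ('v \<Rightarrow> 'k \<Rightarrow> real) \<Rightarrow>
   ('r \<Rightarrow> 'v \<Rightarrow> real) \<Rightarrow> bool" where
  "induced_first_fees I f a p \<longleftrightarrow>
     (\<forall>r\<in>commodities I. orig I r \<notin> hubs I \<longrightarrow>
        (if \<exists>k\<in>carriers I. \<exists>i\<in>hubs I. a (orig I r) k = 1 \<and> f r k i = 1
         then \<exists>k\<in>carriers I. \<exists>i\<in>hubs I. a (orig I r) k = 1 \<and> f r k i = 1 \<and>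
                (\<forall>j\<in>hubs I. p r j = (if j = i then res_price I r k (orig I r) j else 0))
         else \<forall>j\<in>hubs I. p r j = 0))"

definition induced_third_fees ::
  "('v, 'k, 'r) mcfod_data \<Rightarrow> ('r \<Rightarrow> 'k \<Rightarrow> 'v \<Rightarrow> real) \<Rightarrow> ('v \<Rightarrow> 'k \<Rightarrow> real) \<Rightarrow>
   ('r \<Rightarrow> 'v \<Rightarrow> real) \<Rightarrow> bool" where
  "induced_third_fees I t a q \<longleftrightarrow>
     (\<forall>r\<in>commodities I. dest I r \<notin> hubs I \<longrightarrow>
        (if \<exists>l\<in>carriers I. \<exists>j\<in>hubs I. a (dest I r) l = 1 \<and> t r l j = 1
         then \<exists>l\<in>carriers I. \<exists>j\<in>hubs I. a (dest I r) l = 1 \<and> t r l j = 1 \<and>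
                (\<forall>i\<in>hubs I. q r i = (if i = j then res_price I r l i (dest I r) else 0))
         else \<forall>i\<in>hubs I. q r i = 0))"

end

theory Submission imports Defs begin

text \<open>
  The induced fees give every carrier a best response of value zero: at most one carrier is
  allocated, it accepts at most one hub, the fee there equals its reservation price, and all other
  hubs pay nothing. They are also pointwise minimal among the fees that are nonnegative and
  individually rational for the carriers, so replacing the fees of any solution of the relaxed
  problem by them does not decrease the profit. It remains to choose a best routing, and the
  profit takes only finitely many values on binary routings.
\<close>

section \<open>Fees and carrier conditions of a single leg\<close>

text \<open>
  First and third legs are symmetric: \<open>c\<close>, \<open>g\<close>, \<open>b\<close>, \<open>w\<close> stand for the reservation prices,
  acceptances, allocations and fees of one leg of one commodity.
\<close>

definition leg_fees ::
  "'v set \<Rightarrow> 'k set \<Rightarrow> ('k \<Rightarrow> 'v \<Rightarrow> real) \<Rightarrow> ('k \<Rightarrow> 'v \<Rightarrow> real) \<Rightarrow> ('k \<Rightarrow> real) \<Rightarrow> ('v \<Rightarrow> real) \<Rightarrow> bool" where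
  "leg_fees H K c g b w \<longleftrightarrow>
     (if \<exists>k\<in>K. \<exists>i\<in>H. b k = 1 \<and> g k i = 1
      then \<exists>k\<in>K. \<exists>i\<in>H. b k = 1 \<and> g k i = 1 \<and> (\<forall>j\<in>H. w j = (if j = i then c k j else 0))
      else \<forall>j\<in>H. w j = 0)"

text \<open>The routing variables are left out: of the leader constraints only (L1) and (L5), or
  (L6) for a third leg, are kept.\<close>

definition leg_feasible ::
  "'v set \<Rightarrow> 'k set \<Rightarrow> ('k \<Rightarrow> 'v \<Rightarrow> real) \<Rightarrow> ('k \<Rightarrow> 'v \<Rightarrow> real) \<Rightarrow> ('k \<Rightarrow> real) \<Rightarrow> bool" where
  "leg_feasible H K c g b \<longleftrightarrow>
     finite H \<and> H \<noteq> {} \<and> finite K \<and> (\<forall>k\<in>K. b k \<in> {0, 1}) \<and> sum b K \<le> 1 \<and>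
     (\<forall>k\<in>K. \<forall>i\<in>H. g k i \<in> {0, 1} \<and> c k i > 0) \<and> (\<forall>k\<in>K. sum (g k) H \<le> b k)"

text \<open>Two ones would already sum to 2. It is applied to the carriers of a node, by (L1), and
  to the hubs accepted by one carrier.\<close>

lemma binary_sum_le_1_unique:
  fixes h :: "'a \<Rightarrow> real"
  assumes "finite A" "\<forall>x\<in>A. h x \<in> {0, 1}" "sum h A \<le> 1"
    and "x \<in> A" "h x = 1" "y \<in> A" "y \<noteq> x"
  shows "h y = 0"
proof -
  have "sum h {x, y} \<le> sum h A"
    by (rule sum_mono2) (use assms in auto)
  then show ?thesis using assms by auto
qed

text \<open>One accepted hub already uses up the capacity \<open>b k\<close> that (L5) or (L6)
  grants.\<close>

lemma leg_feasible_accepted: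
  assumes "leg_feasible H K c g b" "k \<in> K" "i \<in> H" "g k i = 1"
  shows "b k = 1" and "\<And>j. j \<in> H \<Longrightarrow> j \<noteq> i \<Longrightarrow> g k j = 0"
proof -
  have "g k i \<le> sum (g k) H"
    by (rule member_le_sum) (use assms in \<open>force simp: leg_feasible_def\<close>)+
  moreover have "sum (g k) H \<le> b k" "b k \<in> {0, 1}"
    using assms by (auto simp: leg_feasible_def)
  ultimately show "b k = 1" using assms by auto
  show "g k j = 0" if "j \<in> H" "j \<noteq> i" for j
    by (rule binary_sum_le_1_unique[of H "g k" i])
      (use assms that \<open>sum (g k) H \<le> b k\<close> \<open>b k = 1\<close> in \<open>auto simp: leg_feasible_def\<close>)
qed

text \<open>Only the accepted hub contributes. The fees \<open>w\<close> are arbitrary because both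
  the induced fees and their competitors are evaluated this way.\<close>

lemma leg_value:
  assumes "leg_feasible H K c g b" "k \<in> K" "i \<in> H" "g k i = 1"
  shows "(\<Sum>j\<in>H. (w j - c k j) * g k j) = w i - c k i"
proof -
  have fin: "finite H" using assms by (auto simp: leg_feasible_def)
  have "(\<Sum>j\<in>H. (w j - c k j) * g k j) = (\<Sum>j\<in>H. if j = i then w i - c k i else 0)"
    by (rule sum.cong) (use assms leg_feasible_accepted(2)[OF assms] in auto)
  also have "\<dots> = w i - c k i" using fin assms by (simp add: sum.delta)
  finally show ?thesis .
qed

lemma leg_fees_nonneg:
  assumes "leg_feasible H K c g b" "leg_fees H K c g b w" "i \<in> H"
  shows "0 \<le> w i"
  using assms by (fastforce simp: leg_feasible_def leg_fees_def split: if_splits intro: less_imp_le)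

text \<open>The only positive induced fee sits at an accepted hub, and rationality of the accepting
  carrier forces any competitor \<open>v\<close> to pay at least the reservation price
  there.\<close>

lemma leg_fees_minimal:
  assumes "leg_feasible H K c g b" "leg_fees H K c g b w" "i \<in> H"
    and nonneg: "\<forall>j\<in>H. 0 \<le> v j"
    and rational: "\<forall>k\<in>K. 0 \<le> (\<Sum>j\<in>H. (v j - c k j) * g k j)"
  shows "w i \<le> v i"
proof (cases "\<exists>k\<in>K. \<exists>i\<in>H. b k = 1 \<and> g k i = 1")
  case True
  then obtain k h where k: "k \<in> K" "h \<in> H" "g k h = 1"
      and w: "\<forall>j\<in>H. w j = (if j = h then c k j else 0)"
    using assms(2) unfolding leg_fees_def by auto
  have "0 \<le> v h - c k h"
    using rational k(1) leg_value[OF assms(1) k] by metis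
  then show ?thesis using w nonneg assms(3) by auto
next
  case False
  then show ?thesis using assms by (simp add: leg_fees_def)
qed

text \<open>Both sides are 0: \<open>k\<close> is paid exactly its price if it accepts a hub, and no
  hub offers an allocated carrier more than its price.\<close>

lemma leg_fees_optimal:
  assumes "leg_feasible H K c g b" "leg_fees H K c g b w" "k \<in> K"
  shows "b k * max 0 (Max ((\<lambda>i. w i - c k i) ` H)) \<le> (\<Sum>i\<in>H. (w i - c k i) * g k i)"
proof -
  have H: "finite H" "H \<noteq> {}" and cpos: "\<forall>i\<in>H. c k i > 0"
    and gbin: "\<forall>i\<in>H. g k i \<in> {0, 1}" and bbin: "\<forall>k\<in>K. b k \<in> {0, 1}"
    and K: "finite K" "sum b K \<le> 1"
    using assms by (auto simp: leg_feasible_def)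
  \<comment> \<open>The premise is restricted to \<open>b k = 1\<close> since a fee may well exceed
    the price of a carrier that is not allocated.\<close>
  have best: "b k * max 0 (Max ((\<lambda>i. w i - c k i) ` H)) = 0"
    if "b k = 1 \<Longrightarrow> \<forall>i\<in>H. w i \<le> c k i"
  proof (cases "b k = 1")
    case True
    then have "Max ((\<lambda>i. w i - c k i) ` H) \<le> 0"
      using that H by (subst Max_le_iff) auto
    then show ?thesis by (simp add: max_def)
  next
    case False
    then show ?thesis using bbin assms(3) by auto
  qed
  show ?thesis
  proof (cases "\<exists>i\<in>H. g k i = 1")
    case True
    then obtain i where i: "i \<in> H" "g k i = 1" by blast
    note bk = leg_feasible_accepted[OF assms(1,3) i]
    have "\<exists>k\<in>K. \<exists>i\<in>H. b k = 1 \<and> g k i = 1" using assms(3) i bk by blast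
    note ex = if_P[OF this]
    obtain l h where l: "l \<in> K" "h \<in> H" "b l = 1" "g l h = 1"
      and w: "\<forall>j\<in>H. w j = (if j = h then c l j else 0)"
      using assms(2) unfolding leg_fees_def ex by blast
    \<comment> \<open>The pair that defines \<open>w\<close> comes from an existential; (L1)
      identifies its carrier with \<open>k\<close>, and then (L5) or (L6) its hub with
      \<open>i\<close>.\<close>
    have "l = k"
      using binary_sum_le_1_unique[OF K(1) bbin K(2) assms(3) bk(1) l(1)] l(3) by fastforce
    moreover from this have "h = i" using bk(2)[OF l(2)] l(4) by fastforce
    ultimately have "w i = c k i" "\<forall>j\<in>H. w j \<le> c k j"
      using w i cpos by (auto intro: less_imp_le)
    then show ?thesis using best leg_value[OF assms(1,3) i, of w] by linarith
  next
    case False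
    then have g0: "\<forall>i\<in>H. g k i = 0" using gbin by auto
    \<comment> \<open>By (L1) the carrier of a paying pair would be \<open>k\<close>, which accepts
      nothing; so all fees are 0.\<close>
    have "\<forall>i\<in>H. w i \<le> c k i" if "b k = 1"
    proof (cases "\<exists>l\<in>K. \<exists>i\<in>H. b l = 1 \<and> g l i = 1")
      case True
      then obtain l h where l: "l \<in> K" "h \<in> H" "b l = 1" "g l h = 1" by blast
      have "l = k"
        using binary_sum_le_1_unique[OF K(1) bbin K(2) assms(3) that l(1)] l(3) by fastforce
      then show ?thesis using g0 l by simp
    next
      case False
      then have "\<forall>i\<in>H. w i = 0" using assms(2) by (simp add: leg_fees_def)
      then show ?thesis using cpos by (auto intro: less_imp_le)
    qed
    moreover have "(\<Sum>i\<in>H. (w i - c k i) * g k i) = 0" using g0 by simp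
    ultimately show ?thesis using best by linarith
  qed
qed

section \<open>Transfer from legs to the two problems\<close>

lemma finite_arcs: "finite (hubs I) \<Longrightarrow> finite (arcs I r)"
  by (simp add: arcs_def)

lemma arcs_hubs:
  assumes "(i, j) \<in> arcs I r"
  shows "orig I r \<notin> hubs I \<Longrightarrow> i \<in> hubs I" and "dest I r \<notin> hubs I \<Longrightarrow> j \<in> hubs I"
  using assms by (auto simp: arcs_def split: if_splits)

lemma finite_hubs: "mcfod_instance I \<Longrightarrow> finite (hubs I)"
  unfolding mcfod_instance_def by (meson finite_subset)

lemma first_leg_feasible:
  assumes "mcfod_instance I" "binary_allocation I a f t" "leader_constraints I s a x f t"
    and "r \<in> commodities I" "orig I r \<notin> hubs I"
  shows "leg_feasible (hubs I) (carriers I) (\<lambda>k. res_price I r k (orig I r)) (f r) (a (orig I r))"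
  using assms finite_hubs[OF assms(1)]
  unfolding leg_feasible_def mcfod_instance_def binary_allocation_def leader_constraints_def
  by (simp add: Ball_def)

lemma third_leg_feasible:
  assumes "mcfod_instance I" "binary_allocation I a f t" "leader_constraints I s a x f t"
    and "r \<in> commodities I" "dest I r \<notin> hubs I"
  shows "leg_feasible (hubs I) (carriers I) (\<lambda>k i. res_price I r k i (dest I r)) (t r) (a (dest I r))"
  using assms finite_hubs[OF assms(1)]
  unfolding leg_feasible_def mcfod_instance_def binary_allocation_def leader_constraints_def
  by (simp add: Ball_def)

lemma first_leg_fees:
  "induced_first_fees I f a p \<Longrightarrow> r \<in> commodities I \<Longrightarrow> orig I r \<notin> hubs I \<Longrightarrow>
     leg_fees (hubs I) (carriers I) (\<lambda>k. res_price I r k (orig I r)) (f r) (a (orig I r)) (p r)"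
  unfolding induced_first_fees_def leg_fees_def by blast

lemma third_leg_fees:
  "induced_third_fees I t a q \<Longrightarrow> r \<in> commodities I \<Longrightarrow> dest I r \<notin> hubs I \<Longrightarrow>
     leg_fees (hubs I) (carriers I) (\<lambda>k i. res_price I r k i (dest I r)) (t r) (a (dest I r)) (q r)"
  unfolding induced_third_fees_def leg_fees_def by blast

text \<open>The left-hand sides of the optimality conditions are nonnegative.\<close>

lemma mcfod_feasible_imp_rmcfod_feasible:
  assumes "mcfod_instance I" "mcfod_feasible I s a x f t p q"
  shows "rmcfod_feasible I s a x f t p q"
proof -
  have "a i k \<in> {0, 1}" if "i \<in> nodes I - hubs I" "k \<in> carriers I" for i k
    using assms that unfolding mcfod_feasible_def binary_allocation_def by blast
  then have "0 \<le> a i k * max 0 M" if "i \<in> nodes I - hubs I" "k \<in> carriers I" for i k and M :: real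
    using that by (force intro: mult_nonneg_nonneg)
  then have "carrier_rationality I f t p q"
    using assms unfolding mcfod_feasible_def carrier_rationality_def carrier_optimality_def
      mcfod_instance_def by (meson DiffI order_trans)
  then show ?thesis using assms by (simp add: mcfod_feasible_def rmcfod_feasible_def)
qed

text \<open>The carriers' conditions do not involve the routing, so the induced fees fit every
  admissible \<open>s\<close>, \<open>x\<close>.\<close>

lemma induced_fees_feasible:
  assumes "mcfod_instance I" "binary_allocation I a f t" "binary_routing I s x"
    and "leader_constraints I s a x f t"
    and "induced_first_fees I f a p" "induced_third_fees I t a q"
  shows "mcfod_feasible I s a x f t p q"
proof -
  note first = first_leg_feasible[OF assms(1,2,4)] first_leg_fees[OF assms(5)]
  note third = third_leg_feasible[OF assms(1,2,4)] third_leg_fees[OF assms(6)]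
  have "nonneg_fees I p q"
    unfolding nonneg_fees_def
    using leg_fees_nonneg[OF first] leg_fees_nonneg[OF third] by blast
  moreover have "carrier_optimality I a f t p q"
    unfolding carrier_optimality_def rho_def gam_def
    using leg_fees_optimal[OF first] leg_fees_optimal[OF third] by blast
  ultimately show ?thesis using assms by (simp add: mcfod_feasible_def)
qed

text \<open>With the routing kept, fees enter the profit only with the coefficients
  \<open>- x r i j\<close>, which are at most 0, and the induced fees are pointwise minimal.\<close>

lemma profit_le_induced_fees:
  assumes "mcfod_instance I" "rmcfod_feasible I s a x f t p' q'"
    and "induced_first_fees I f a p" "induced_third_fees I t a q"
  shows "profit I s x p' q' \<le> profit I s x p q"
proof -
  have feas: "binary_allocation I a f t" "binary_routing I s x" "nonneg_fees I p' q'"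
      "leader_constraints I s a x f t" "carrier_rationality I f t p' q'"
    using assms(2) by (simp_all add: rmcfod_feasible_def)
  have p: "p r i \<le> p' r i" if "r \<in> commodities I" "orig I r \<notin> hubs I" "i \<in> hubs I" for r i
    by (rule leg_fees_minimal[OF first_leg_feasible[OF assms(1) feas(1,4) that(1,2)]
          first_leg_fees[OF assms(3) that(1,2)] that(3)])
      (use feas that in \<open>auto simp: nonneg_fees_def carrier_rationality_def rho_def\<close>)
  have q: "q r i \<le> q' r i" if "r \<in> commodities I" "dest I r \<notin> hubs I" "i \<in> hubs I" for r i
    by (rule leg_fees_minimal[OF third_leg_feasible[OF assms(1) feas(1,4) that(1,2)]
          third_leg_fees[OF assms(4) that(1,2)] that(3)])
      (use feas that in \<open>auto simp: nonneg_fees_def carrier_rationality_def gam_def\<close>)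
  have "(\<Sum>r\<in>commodities I. \<Sum>(i, j)\<in>arcs I r.
        (hub_cost I r i j + (if orig I r \<in> hubs I then 0 else p r i)
          + (if dest I r \<in> hubs I then 0 else q r j)) * x r i j)
      \<le> (\<Sum>r\<in>commodities I. \<Sum>(i, j)\<in>arcs I r.
        (hub_cost I r i j + (if orig I r \<in> hubs I then 0 else p' r i)
          + (if dest I r \<in> hubs I then 0 else q' r j)) * x r i j)"
  proof (intro sum_mono, clarify)
    fix r i j assume r: "r \<in> commodities I" and ij: "(i, j) \<in> arcs I r"
    have "0 \<le> x r i j" using feas(2) r ij unfolding binary_routing_def by fastforce
    moreover note p[OF r _ arcs_hubs(1)[OF ij]] q[OF r _ arcs_hubs(2)[OF ij]]
    ultimately show "(hub_cost I r i j + (if orig I r \<in> hubs I then 0 else p r i)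
          + (if dest I r \<in> hubs I then 0 else q r j)) * x r i j
      \<le> (hub_cost I r i j + (if orig I r \<in> hubs I then 0 else p' r i)
          + (if dest I r \<in> hubs I then 0 else q' r j)) * x r i j"
      by (intro mult_right_mono add_mono) auto
  qed
  then show ?thesis by (simp add: profit_def)
qed

section \<open>Existence of a best routing\<close>

text \<open>
  There are infinitely many binary routings as total functions, so finiteness is obtained by
  encoding the relevant values as subsets of finite index sets.
\<close>

lemma finite_profits:
  assumes "mcfod_instance I"
  shows "finite {profit I s x p q |s x. binary_routing I s x}"
proof -
  let ?R = "commodities I" and ?X = "SIGMA r:commodities I. arcs I r"
  let ?F = "\<lambda>(S, X). profit I (\<lambda>r. of_bool (r \<in> S)) (\<lambda>r i j. of_bool ((r, i, j) \<in> X)) p q"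
  have "finite ?R" using assms by (simp add: mcfod_instance_def)
  then have "finite (Pow ?R \<times> Pow ?X)"
    using finite_arcs[OF finite_hubs[OF assms]] by auto
  moreover have "{profit I s x p q |s x. binary_routing I s x} \<subseteq> ?F ` (Pow ?R \<times> Pow ?X)"
  proof clarify
    fix s x assume bin: "binary_routing I s x"
    let ?S = "{r \<in> ?R. s r = 1}" and ?Y = "{(r, i, j) \<in> ?X. x r i j = 1}"
    have s: "s r = of_bool (r \<in> ?S)" if "r \<in> ?R" for r
      using bin that by (auto simp: binary_routing_def)
    have x: "x r i j = of_bool ((r, i, j) \<in> ?Y)" if "r \<in> ?R" "(i, j) \<in> arcs I r" for r i j
      using bin that by (fastforce simp: binary_routing_def)
    \<comment> \<open>The profit reads \<open>s\<close> and \<open>x\<close> only on their index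
      sets, where they agree with the indicator functions.\<close>
    have "profit I s x p q = ?F (?S, ?Y)"
      unfolding profit_def split_def fst_conv snd_conv
      by (intro arg_cong2[where f = minus] sum.cong refl arg_cong2[where f = times])
        (use s x in auto)
    then show "profit I s x p q \<in> ?F ` (Pow ?R \<times> Pow ?X)" by (rule image_eqI) auto
  qed
  ultimately show ?thesis by (rule finite_surj)
qed

theorem proposition4p1:
  fixes I :: "('v, 'k, 'r) mcfod_data"
    and f t :: "'r \<Rightarrow> 'k \<Rightarrow> 'v \<Rightarrow> real"
    and a :: "'v \<Rightarrow> 'k \<Rightarrow> real"
    and p q :: "'r \<Rightarrow> 'v \<Rightarrow> real"
  assumes "mcfod_instance I"
    and "binary_allocation I a f t"
    and "\<exists>x s. binary_routing I s x \<and> leader_constraints I s a x f t"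
    and "induced_first_fees I f a p"
    and "induced_third_fees I t a q"
  shows "(\<exists>s x. mcfod_fixed_optimal I f t a (s, x, p, q)) \<and>
         (\<exists>s x. rmcfod_fixed_optimal I f t a (s, x, p, q))"
proof -
  let ?ok = "\<lambda>s x. binary_routing I s x \<and> leader_constraints I s a x f t"
  let ?P = "{profit I s x p q |s x. ?ok s x}"
  have fin: "finite ?P" by (rule finite_subset[OF _ finite_profits[OF assms(1), of p q]]) auto
  moreover have "?P \<noteq> {}" using assms(3) by auto
  ultimately have "Max ?P \<in> ?P" by (rule Max_in)
  then obtain s x where ok: "?ok s x" and max: "Max ?P = profit I s x p q" by auto
  \<comment> \<open>A bound over the larger, relaxed feasible set settles both problems, so one
    routing serves for both.\<close>
  have best: "profit I s' x' p' q' \<le> profit I s x p q"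
    if "rmcfod_feasible I s' a x' f t p' q'" for s' x' p' q'
  proof -
    have "profit I s' x' p' q' \<le> profit I s' x' p q"
      by (rule profit_le_induced_fees[OF assms(1) that assms(4,5)])
    also have "\<dots> \<le> Max ?P"
      by (rule Max_ge[OF fin]) (use that in \<open>auto simp: rmcfod_feasible_def\<close>)
    finally show ?thesis using max by simp
  qed
  have feas: "mcfod_feasible I s a x f t p q"
    using induced_fees_feasible assms ok by blast
  have "mcfod_fixed_optimal I f t a (s, x, p, q)"
    using feas best mcfod_feasible_imp_rmcfod_feasible[OF assms(1)]
    by (auto simp: mcfod_fixed_optimal_def is_arg_max_def not_less)
  moreover have "rmcfod_fixed_optimal I f t a (s, x, p, q)"
    using mcfod_feasible_imp_rmcfod_feasible[OF assms(1) feas] best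
    by (auto simp: rmcfod_fixed_optimal_def is_arg_max_def not_less)
  ultimately show ?thesis by blast
qed

end
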